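(* Let $\mu$ be a multiplicity on $\mathcal{A}$ and $\theta_1,\dots,\theta_\ell\in\mathrm{Der}_S$. Then the following are equivalent: (1) $\{\theta_1,\dots,\theta_\ell\}$ is a basis for $D(\mathcal{A},\mu)$; (2) $\{\phi_q(\theta_1),\dots,\phi_q(\theta_\ell)\}$ is a basis for $D(\mathcal{A},q\mu)$.
   Context: Let $q=p^d$ be a prime power, $S=\mathbb{F}_q[x_1,\dots,x_\ell]$ and $\mathrm{Der}_S=\bigoplus_{i=1}^\ell S\partial_{x_i}$. Let $\mathcal{A}$ be a finite set of linear hyperplanes in $\mathbb{F}_q^\ell$; for $H\in\mathcal{A}$ fix a linear form $\alpha_H$ with coefficients in $\mathbb{F}_q$ and $H=\ker\alpha_H$. A multiplicity is a map $\mu:\mathcal{A}\to\mathbb{Z}_{\ge0}$, and $D(\mathcal{A},\mu)=\{\theta\in\mathrm{Der}_S:\theta(\alpha_H)\in\alpha_H^{\mu(H)}S\ \text{for all } H\in\mathcal{A}\}$; $q\mu$ is the multiplicity $H\mapsto q\mu(H)$. $\phi_q:S\to S$ is the Frobenius map $f\mapsto f^q$, extended to $\mathrm{Der}_S$ by $\phi_q(\sum_i f_i\partial_{x_i})=\sum_i\phi_q(f_i)\partial_{x_i}$. *)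

theory Defs
  imports "HOL-Analysis.Analysis" "HOL-Library.Poly_Mapping"
begin

text \<open>
  The finite field \<open>\<F>\<^sub>q\<close> is a type \<open>'k :: {field, finite}\<close>, so that \<open>q = CARD('k)\<close>, and the
  variables \<open>x\<^sub>1, \<dots>, x\<^sub>\<ell>\<close> are indexed by a finite type \<open>'n\<close>, so that \<open>\<ell> = CARD('n)\<close>. A polynomial
  is a finitely supported map from exponent vectors to coefficients; the ring structure
  (convolution product) is the one of \<^theory>\<open>HOL-Library.Poly_Mapping\<close>.
\<close>

type_synonym ('n, 'k) mpoly = "('n \<Rightarrow>\<^sub>0 nat) \<Rightarrow>\<^sub>0 'k"

text \<open>
  The free module \<open>Der\<^sub>S = \<Oplus>\<^sub>i S \<partial>\<^bsub>x\<^sub>i\<^esub>\<close>: the vector \<open>\<theta>\<close> stands for \<open>\<Sum>\<^sub>i (\<theta> $ i) \<partial>\<^bsub>x\<^sub>i\<^esub>\<close>, and the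
  \<open>S\<close>-action is \<open>(*s)\<close>.
\<close>

type_synonym ('n, 'k) der = "(('n, 'k) mpoly) ^ 'n"

definition mpoly_eval :: "('n::finite, 'k::field) mpoly \<Rightarrow> 'k ^ 'n \<Rightarrow> 'k" where
  "mpoly_eval f v =
     (\<Sum>m\<in>Poly_Mapping.keys f.
        Poly_Mapping.lookup f m * (\<Prod>i\<in>UNIV. (v $ i) ^ Poly_Mapping.lookup m i))"

text \<open>The truncated subtraction of exponents is harmless: if \<open>x\<^sub>i\<close> does not occur in the
  monomial \<open>m\<close>, then the coefficient of the summand is \<open>0\<close>.\<close>

definition partial_deriv :: "'n \<Rightarrow> ('n::finite, 'k::field) mpoly \<Rightarrow> ('n, 'k) mpoly" where
  "partial_deriv i f =
     (\<Sum>m\<in>Poly_Mapping.keys f.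
        Poly_Mapping.single (m - Poly_Mapping.single i 1)
          (of_nat (Poly_Mapping.lookup m i) * Poly_Mapping.lookup f m))"

definition der_apply :: "('n::finite, 'k::field) der \<Rightarrow> ('n, 'k) mpoly \<Rightarrow> ('n, 'k) mpoly" where
  "der_apply \<theta> f = (\<Sum>i\<in>UNIV. \<theta> $ i * partial_deriv i f)"

definition is_linear_form :: "('n::finite, 'k::field) mpoly \<Rightarrow> bool" where
  "is_linear_form f \<longleftrightarrow>
     (\<exists>c :: 'k ^ 'n. f = (\<Sum>i\<in>UNIV. Poly_Mapping.single (Poly_Mapping.single i 1) (c $ i)))"

definition linear_hyperplane :: "('k::field ^ 'n::finite) set \<Rightarrow> bool" where
  "linear_hyperplane H \<longleftrightarrow> vec.subspace H \<and> vec.dim H + 1 = CARD('n)"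

definition arrangement :: "('k::field ^ 'n::finite) set set \<Rightarrow> bool" where
  "arrangement \<A> \<longleftrightarrow> finite \<A> \<and> (\<forall>H\<in>\<A>. linear_hyperplane H)"

definition defining_forms ::
  "('k::field ^ 'n::finite) set set \<Rightarrow> (('k ^ 'n) set \<Rightarrow> ('n, 'k) mpoly) \<Rightarrow> bool" where
  "defining_forms \<A> \<alpha> \<longleftrightarrow>
     (\<forall>H\<in>\<A>. is_linear_form (\<alpha> H) \<and> H = {v. mpoly_eval (\<alpha> H) v = 0})"

definition log_der ::
  "('k::field ^ 'n::finite) set set \<Rightarrow> (('k ^ 'n) set \<Rightarrow> ('n, 'k) mpoly) \<Rightarrow>
   (('k ^ 'n) set \<Rightarrow> nat) \<Rightarrow> ('n, 'k) der set" where
  "log_der \<A> \<alpha> \<mu> = {\<theta>. \<forall>H\<in>\<A>. \<alpha> H ^ \<mu> H dvd der_apply \<theta> (\<alpha> H)}"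

definition frobenius :: "('n::finite, 'k::{field, finite}) mpoly \<Rightarrow> ('n, 'k) mpoly" where
  "frobenius f = f ^ CARD('k)"

definition frobenius_der :: "('n::finite, 'k::{field, finite}) der \<Rightarrow> ('n, 'k) der" where
  "frobenius_der \<theta> = (\<chi> i. frobenius (\<theta> $ i))"

lemma module_der: "module ((*s) :: ('n::finite, 'k::field) mpoly \<Rightarrow> ('n, 'k) der \<Rightarrow> ('n, 'k) der)"
  by unfold_locales (simp_all add: vec_eq_iff algebra_simps)

text \<open>An indexed basis of an \<open>S\<close>-submodule \<open>M\<close> of \<open>Der\<^sub>S\<close>; injectivity says that the listed members
  are distinct, so that independence of the set is independence of the family.\<close>

definition is_basis :: "('i \<Rightarrow> ('n::finite, 'k::field) der) \<Rightarrow> ('n, 'k) der set \<Rightarrow> bool" where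
  "is_basis \<theta> M \<longleftrightarrow>
     inj \<theta> \<and> \<not> module.dependent (*s) (range \<theta>) \<and> module.span (*s) (range \<theta>) = M"

end

theory Submission
  imports Defs "HOL-Computational_Algebra.Polynomial"
begin

text \<open>
  Write \<open>S\<^sup>q\<close> for the image of \<open>\<phi>\<^sub>q\<close>. The ring \<open>S\<close> is free over \<open>S\<^sup>q\<close> on the monomials \<open>x\<^sup>a\<close> with all
  exponents below \<open>q\<close>, so that every \<open>f\<close> is uniquely \<open>\<Sum>\<^sub>a x\<^sup>a \<phi>\<^sub>q(f\<^sub>a)\<close>, and likewise for derivations.
  The components satisfy \<open>(\<phi>\<^sub>q(g) f)\<^sub>a = g f\<^sub>a\<close>, and linear forms over \<open>\<F>\<^sub>q\<close> have Frobenius-invariant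
  coefficients. Hence \<open>\<theta>\<close> lies in \<open>D(\<A>, q\<mu>)\<close> iff all its components lie in \<open>D(\<A>, \<mu>)\<close>, and \<open>\<theta>\<close> lies in
  the span of the \<open>\<phi>\<^sub>q(\<theta>\<^sub>i)\<close> iff all its components lie in the span of the \<open>\<theta>\<^sub>i\<close>. A submodule \<open>M\<close> is
  recovered from \<open>{\<theta>. all components of \<theta> lie in M}\<close> as the preimage under \<open>\<phi>\<^sub>q\<close>, so the two
  spanning conditions are equivalent; independence transfers componentwise.
\<close>

section \<open>Frobenius over a finite field\<close>

text \<open>Multiplication by a nonzero \<open>x\<close> permutes the nonzero elements. Comparing
  their product before and after gives \<open>x ^ (CARD('k) - 1) = 1\<close>.\<close>

lemma finite_field_power_card:
  fixes x :: "'k::{field, finite}"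
  shows "x ^ CARD('k) = x"
proof (cases "x = 0")
  case True
  then show ?thesis by (simp add: zero_power)
next
  case False
  have "bij_betw ((*) x) (UNIV - {0}) (UNIV - {0})"
    using False by (intro bij_betwI[where g = "\<lambda>y. y / x"]) auto
  then have "(\<Prod>y\<in>UNIV - {0}. x * y) = \<Prod>(UNIV - {0})"
    by (rule prod.reindex_bij_betw)
  then have "x ^ card (UNIV - {0 :: 'k}) * \<Prod>(UNIV - {0}) = \<Prod>(UNIV - {0})"
    by (simp add: prod.distrib)
  then have "x ^ (CARD('k) - 1) = 1"
    by simp
  then have "x * x ^ (CARD('k) - 1) = x"
    by simp
  then show ?thesis
    by (simp flip: power_Suc)
qed

text \<open>The polynomial \<open>(X + 1)\<^sup>q - X\<^sup>q - 1\<close> has degree below \<open>q\<close> and vanishes on the whole field.\<close>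

lemma of_nat_card_choose_eq_0:
  assumes "0 < j" "j < CARD('k)"
  shows "of_nat (CARD('k) choose j) = (0 :: 'k::{field, finite})"
proof -
  define q where "q = CARD('k)"
  define P :: "'k poly" where "P = (\<Sum>i\<in>{1..<q}. monom (of_nat (q choose i)) i)"
  have q: "q > 0" by (simp add: q_def)
  have "poly P x = 0" for x
  proof -
    have "x + 1 = (x + 1) ^ q"
      unfolding q_def by (rule finite_field_power_card[symmetric])
    also have "\<dots> = (\<Sum>i\<le>q. of_nat (q choose i) * x ^ i)"
      by (simp add: binomial_ring)
    also have "{..q} = insert 0 (insert q {1..<q})"
      by auto
    also have "(\<Sum>i\<in>\<dots>. of_nat (q choose i) * x ^ i) = 1 + (x ^ q + poly P x)"
      using q by (simp add: P_def poly_sum poly_monom)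
    also have "x ^ q = x"
      unfolding q_def by (rule finite_field_power_card)
    finally show ?thesis by simp
  qed
  then have "q \<le> degree P" if "P \<noteq> 0"
    using card_poly_roots_bound[OF that] by (simp add: q_def)
  moreover have "degree P \<le> q - 1"
    unfolding P_def by (intro degree_sum_le) (auto intro: order.trans[OF degree_monom_le])
  ultimately have "P = 0"
    using q by linarith
  then have "coeff P j = 0" by simp
  then show ?thesis
    using assms by (simp add: P_def coeff_sum q_def)
qed

lemma frobenius_0 [simp]: "frobenius 0 = 0"
  by (simp add: frobenius_def zero_power)

lemma frobenius_mult: "frobenius (f * g) = frobenius f * frobenius g"
  by (simp add: frobenius_def power_mult_distrib)

lemma frobenius_power: "frobenius (f ^ n) = f ^ (CARD('k) * n)"
  for f :: "('n::finite, 'k::{field, finite}) mpoly"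
  by (simp add: frobenius_def mult.commute flip: power_mult)

lemma frobenius_add:
  fixes f g :: "('n::finite, 'k::{field, finite}) mpoly"
  shows "frobenius (f + g) = frobenius f + frobenius g"
proof -
  define q where "q = CARD('k)"
  have q: "q > 0" by (simp add: q_def)
  \<comment> \<open>A natural number in the polynomial ring is the constant polynomial with its
    value in the field, so the vanishing carries over. Here \<open>q\<close> may be a proper prime
    power.\<close>
  have *: "of_nat (q choose i) = (0 :: ('n, 'k) mpoly)" if "0 < i" "i < q" for i
    using of_nat_card_choose_eq_0[where ?'k = 'k, of i] that single_of_nat[of "q choose i"]
    by (metis q_def single_zero)
  have "(f + g) ^ q = (\<Sum>i\<le>q. of_nat (q choose i) * f ^ i * g ^ (q - i))"
    by (rule binomial_ring)
  also have "{..q} = insert 0 (insert q {1..<q})"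
    by auto
  also have "(\<Sum>i\<in>\<dots>. of_nat (q choose i) * f ^ i * g ^ (q - i)) = g ^ q + f ^ q"
    using q by (simp add: *)
  finally show ?thesis
    by (simp add: frobenius_def q_def)
qed

lemma frobenius_sum: "frobenius (\<Sum>i\<in>A. f i) = (\<Sum>i\<in>A. frobenius (f i))"
  by (induction A rule: infinite_finite_induct) (simp_all add: frobenius_add)

section \<open>Frobenius on monomials\<close>

lemma map_0 [simp]: "Poly_Mapping.map f 0 = 0"
  by transfer simp

text \<open>\<open>Poly_Mapping.map\<close> never alters a zero entry. Scaling, \<open>div\<close>
  and \<open>mod\<close> all send 0 to 0, so each of them acts pointwise on every exponent.\<close>

lemma lookup_map_times:
  "Poly_Mapping.lookup (Poly_Mapping.map ((*) n) m) i = n * Poly_Mapping.lookup m i" for n :: nat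
  by (simp add: Poly_Mapping.map.rep_eq when_def)

lemma lookup_map_div:
  "Poly_Mapping.lookup (Poly_Mapping.map (\<lambda>x. x div n) m) i = Poly_Mapping.lookup m i div n" for n :: nat
  by (simp add: Poly_Mapping.map.rep_eq when_def)

lemma lookup_map_mod:
  "Poly_Mapping.lookup (Poly_Mapping.map (\<lambda>x. x mod n) m) i = Poly_Mapping.lookup m i mod n" for n :: nat
  by (simp add: Poly_Mapping.map.rep_eq when_def)

lemma single_power:
  "Poly_Mapping.single m c ^ n = Poly_Mapping.single (Poly_Mapping.map ((*) n) m) (c ^ n)"
  for m :: "'n \<Rightarrow>\<^sub>0 nat" and c :: "'k::comm_semiring_1"
proof (induction n)
  case 0
  have "Poly_Mapping.map ((*) 0) m = 0"
    by (rule poly_mapping_eqI) (simp add: lookup_map_times)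
  then show ?case by (simp only: power_0 single_one)
next
  case (Suc n)
  have "m + Poly_Mapping.map ((*) n) m = Poly_Mapping.map ((*) (Suc n)) m"
    by (rule poly_mapping_eqI) (simp add: lookup_map_times lookup_add)
  with Suc show ?case by (simp only: power_Suc mult_single)
qed

text \<open>Since \<open>c ^ q = c\<close> in the field, Frobenius changes exponents only and is
  linear over the field.\<close>

lemma frobenius_single:
  "frobenius (Poly_Mapping.single m c) =
     Poly_Mapping.single (Poly_Mapping.map ((*) CARD('k)) m) (c :: 'k::{field, finite})"
  by (simp add: frobenius_def single_power finite_field_power_card)

section \<open>The polynomial ring as a free module over its Frobenius image\<close>

text \<open>The \<open>itself\<close> argument supplies \<open>q\<close>, because the type of
  exponent vectors does not mention \<open>'k\<close>.\<close>

definition residues :: "'k itself \<Rightarrow> ('n::finite \<Rightarrow>\<^sub>0 nat) set" where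
  "residues _ = {a. \<forall>i. Poly_Mapping.lookup a i < CARD('k)}"

text \<open>The coefficients are pulled back along \<open>m \<mapsto> q m + a\<close>, with no q-th
  root taken, because Frobenius fixes the field. \<open>map_key\<close> is meaningful only for
  injective key maps, whence \<open>inj_scale_add\<close>.\<close>

definition frob_comp :: "('n \<Rightarrow>\<^sub>0 nat) \<Rightarrow> ('n::finite, 'k::{field, finite}) mpoly \<Rightarrow> ('n, 'k) mpoly" where
  "frob_comp a = Poly_Mapping.map_key (\<lambda>m. Poly_Mapping.map ((*) CARD('k)) m + a)"

lemma finite_residues: "finite (residues TYPE('k::finite) :: ('n::finite \<Rightarrow>\<^sub>0 nat) set)"
proof (rule inj_on_finite)
  show "inj_on Poly_Mapping.lookup (residues TYPE('k) :: ('n \<Rightarrow>\<^sub>0 nat) set)"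
    by (simp add: inj_on_def poly_mapping.lookup_inject)
  show "Poly_Mapping.lookup ` residues TYPE('k) \<subseteq> (UNIV :: 'n set) \<rightarrow>\<^sub>E {..<CARD('k)}"
    by (auto simp: residues_def)
qed (auto intro: finite_PiE)

lemma zero_in_residues: "0 \<in> residues TYPE('k::finite)"
  by (simp add: residues_def)

lemma mod_in_residues:
  "Poly_Mapping.map (\<lambda>x. x mod CARD('k)) m \<in> residues TYPE('k::finite)"
  by (simp add: residues_def lookup_map_mod)

lemma inj_scale_add:
  "inj (\<lambda>m :: 'n \<Rightarrow>\<^sub>0 nat. Poly_Mapping.map ((*) CARD('k::finite)) m + a)"
  by (auto simp: inj_on_def poly_mapping_eq_iff fun_eq_iff lookup_add lookup_map_times)

lemma frob_comp_0 [simp]: "frob_comp a 0 = 0"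
  unfolding frob_comp_def by (rule map_key_zero[OF inj_scale_add])

lemma frob_comp_add: "frob_comp a (f + g) = frob_comp a f + frob_comp a g"
  unfolding frob_comp_def by (rule map_key_plus[OF inj_scale_add])

lemma frob_comp_sum: "frob_comp a (\<Sum>i\<in>A. f i) = (\<Sum>i\<in>A. frob_comp a (f i))"
  by (induction A rule: infinite_finite_induct) (simp_all add: frob_comp_add)

lemma lookup_frob_comp:
  "Poly_Mapping.lookup (frob_comp a f) m =
     Poly_Mapping.lookup f (Poly_Mapping.map ((*) CARD('k)) m + a)"
  for f :: "('n::finite, 'k::{field, finite}) mpoly"
  unfolding frob_comp_def by (simp add: map_key.rep_eq[OF inj_scale_add])

text \<open>Division with remainder by \<open>q\<close>, entry by entry, is unique once the
  remainders lie below \<open>q\<close>.\<close>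

lemma frob_comp_single:
  fixes c :: "'k::{field, finite}" and a :: "'n::finite \<Rightarrow>\<^sub>0 nat"
  assumes "a \<in> residues TYPE('k)"
  shows "frob_comp a (Poly_Mapping.single m c) =
    (if Poly_Mapping.map (\<lambda>x. x mod CARD('k)) m = a
     then Poly_Mapping.single (Poly_Mapping.map (\<lambda>x. x div CARD('k)) m) c else 0)"
proof -
  have "m = Poly_Mapping.map ((*) CARD('k)) n + a \<longleftrightarrow>
      Poly_Mapping.map (\<lambda>x. x mod CARD('k)) m = a \<and> Poly_Mapping.map (\<lambda>x. x div CARD('k)) m = n" for n
  proof -
    have *: "x = CARD('k) * y + z \<longleftrightarrow> x mod CARD('k) = z \<and> x div CARD('k) = y" if "z < CARD('k)" for x y z
      using that by auto
    show ?thesis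
      using assms by (auto simp: poly_mapping_eq_iff fun_eq_iff lookup_add lookup_map_times
          lookup_map_div lookup_map_mod residues_def *)
  qed
  then show ?thesis
    by (intro poly_mapping_eqI) (auto simp: lookup_frob_comp lookup_single when_def)
qed

lemma poly_mapping_eq_sum_single:
  "f = (\<Sum>m\<in>Poly_Mapping.keys f. Poly_Mapping.single m (Poly_Mapping.lookup f m))"
proof (rule poly_mapping_eqI)
  fix k
  have "Poly_Mapping.lookup (\<Sum>m\<in>Poly_Mapping.keys f. Poly_Mapping.single m (Poly_Mapping.lookup f m)) k
      = (\<Sum>m\<in>Poly_Mapping.keys f. if m = k then Poly_Mapping.lookup f m else 0)"
    by (simp add: lookup_sum lookup_single when_def)
  also have "\<dots> = Poly_Mapping.lookup f k"
    by (simp add: sum.delta' in_keys_iff)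
  finally show "Poly_Mapping.lookup f k = Poly_Mapping.lookup
      (\<Sum>m\<in>Poly_Mapping.keys f. Poly_Mapping.single m (Poly_Mapping.lookup f m)) k" ..
qed

lemma poly_mapping_single_add_induct [case_names zero single add]:
  fixes f :: "'a \<Rightarrow>\<^sub>0 'b::comm_monoid_add"
  assumes "P 0" "\<And>m c. P (Poly_Mapping.single m c)" "\<And>f g. P f \<Longrightarrow> P g \<Longrightarrow> P (f + g)"
  shows "P f"
proof -
  have "P (\<Sum>m\<in>A. Poly_Mapping.single m (Poly_Mapping.lookup f m))" for A
    by (induction A rule: infinite_finite_induct) (use assms in auto)
  then show ?thesis
    by (subst poly_mapping_eq_sum_single)
qed

text \<open>Both sides are additive in \<open>g\<close> and in \<open>f\<close>, which leaves
  monomials. There, adding \<open>q n\<close> to an exponent vector keeps its remainders and shifts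
  its quotients by \<open>n\<close>.\<close>

lemma frob_comp_frobenius_mult:
  fixes f g :: "('n::finite, 'k::{field, finite}) mpoly"
  assumes a: "a \<in> residues TYPE('k)"
  shows "frob_comp a (frobenius g * f) = g * frob_comp a f"
proof (induction g rule: poly_mapping_single_add_induct)
  case (single n d)
  show ?case
  proof (induction f rule: poly_mapping_single_add_induct)
    case (single m c)
    have "Poly_Mapping.map (\<lambda>x. x mod CARD('k)) (Poly_Mapping.map ((*) CARD('k)) n + m)
        = Poly_Mapping.map (\<lambda>x. x mod CARD('k)) m"
      and "Poly_Mapping.map (\<lambda>x. x div CARD('k)) (Poly_Mapping.map ((*) CARD('k)) n + m)
        = n + Poly_Mapping.map (\<lambda>x. x div CARD('k)) m"
      by (simp_all add: poly_mapping_eq_iff fun_eq_iff lookup_add lookup_map_times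
          lookup_map_div lookup_map_mod)
    then show ?case
      by (simp add: frobenius_single mult_single frob_comp_single[OF a])
  qed (simp_all add: algebra_simps frob_comp_add)
qed (simp_all add: algebra_simps frob_comp_add frobenius_add)

text \<open>By additivity it suffices to treat a monomial. Only the residue \<open>m mod q\<close>
  contributes, and \<open>m = m mod q + q (m div q)\<close>.\<close>

lemma frob_comp_decompose:
  fixes f :: "('n::finite, 'k::{field, finite}) mpoly"
  shows "f = (\<Sum>a\<in>residues TYPE('k). Poly_Mapping.single a 1 * frobenius (frob_comp a f))"
proof (induction f rule: poly_mapping_single_add_induct)
  case (single m c)
  let ?a = "Poly_Mapping.map (\<lambda>x. x mod CARD('k)) m"
  let ?n = "Poly_Mapping.map (\<lambda>x. x div CARD('k)) m"
  have "(\<Sum>a\<in>residues TYPE('k). Poly_Mapping.single a 1 * frobenius (frob_comp a (Poly_Mapping.single m c)))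
      = (\<Sum>a\<in>residues TYPE('k). if ?a = a
           then Poly_Mapping.single a 1 * frobenius (Poly_Mapping.single ?n c) else 0)"
    by (intro sum.cong) (simp_all add: frob_comp_single)
  also have "\<dots> = Poly_Mapping.single ?a 1 * frobenius (Poly_Mapping.single ?n c)"
    by (simp add: sum.delta' finite_residues mod_in_residues)
  also have "\<dots> = Poly_Mapping.single (?a + Poly_Mapping.map ((*) CARD('k)) ?n) c"
    by (simp add: frobenius_single mult_single)
  also have "?a + Poly_Mapping.map ((*) CARD('k)) ?n = m"
    by (simp add: poly_mapping_eq_iff fun_eq_iff lookup_add lookup_map_times
          lookup_map_div lookup_map_mod)
  finally show ?case ..
next
  case (add f g)
  have "(\<Sum>a\<in>residues TYPE('k). Poly_Mapping.single a 1 * frobenius (frob_comp a (f + g)))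
    = (\<Sum>a\<in>residues TYPE('k). Poly_Mapping.single a 1 * frobenius (frob_comp a f))
    + (\<Sum>a\<in>residues TYPE('k). Poly_Mapping.single a 1 * frobenius (frob_comp a g))"
    by (simp add: frob_comp_add frobenius_add distrib_left sum.distrib)
  also have "\<dots> = f + g"
    by (simp flip: add)
  finally show ?case ..
qed simp

lemma frob_comp_eq_0_imp:
  fixes f :: "('n::finite, 'k::{field, finite}) mpoly"
  assumes "\<And>a. a \<in> residues TYPE('k) \<Longrightarrow> frob_comp a f = 0"
  shows "f = 0"
  by (subst frob_comp_decompose) (simp add: assms)

lemma frob_comp_0_1 [simp]: "frob_comp 0 1 = (1 :: ('n::finite, 'k::{field, finite}) mpoly)"
  using frob_comp_single[OF zero_in_residues, of 0 "1 :: 'k"] by simp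

text \<open>The factor \<open>frob_comp a 1\<close> is 1 at \<open>a = 0\<close> and 0 at every
  other residue, so \<open>frob_comp 0\<close> is a left inverse of Frobenius. Keeping the factor
  avoids a case split.\<close>

lemma frob_comp_frobenius:
  fixes g :: "('n::finite, 'k::{field, finite}) mpoly"
  shows "a \<in> residues TYPE('k) \<Longrightarrow> frob_comp a (frobenius g) = frob_comp a 1 * g"
  using frob_comp_frobenius_mult[of a g 1] by (simp add: mult.commute)

text \<open>Components of a multiple of \<open>frobenius g\<close> are multiples of \<open>g\<close>
  by semilinearity. Conversely, every summand of the decomposition is divisible because Frobenius is
  multiplicative.\<close>

lemma frobenius_dvd_iff:
  fixes f g :: "('n::finite, 'k::{field, finite}) mpoly"
  shows "frobenius g dvd f \<longleftrightarrow> (\<forall>a\<in>residues TYPE('k). g dvd frob_comp a f)"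
proof
  assume "frobenius g dvd f"
  then show "\<forall>a\<in>residues TYPE('k). g dvd frob_comp a f"
    by (auto elim!: dvdE simp: frob_comp_frobenius_mult)
next
  assume "\<forall>a\<in>residues TYPE('k). g dvd frob_comp a f"
  then have "frobenius g dvd (\<Sum>a\<in>residues TYPE('k). Poly_Mapping.single a 1 * frobenius (frob_comp a f))"
    by (intro dvd_sum dvd_mult) (auto elim!: dvdE simp: frobenius_mult)
  then show "frobenius g dvd f"
    by (simp flip: frob_comp_decompose)
qed

section \<open>Components of derivations\<close>

definition frob_comp_der :: "('n \<Rightarrow>\<^sub>0 nat) \<Rightarrow> ('n::finite, 'k::{field, finite}) der \<Rightarrow> ('n, 'k) der" where
  "frob_comp_der a \<theta> = (\<chi> i. frob_comp a (\<theta> $ i))"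

lemma frob_comp_der_frobenius_der:
  fixes \<theta> :: "('n::finite, 'k::{field, finite}) der"
  shows "a \<in> residues TYPE('k) \<Longrightarrow> frob_comp_der a (frobenius_der \<theta>) = frob_comp a 1 *s \<theta>"
  by (simp add: frob_comp_der_def frobenius_der_def vec_eq_iff frob_comp_frobenius)

lemma frob_comp_der_combination:
  fixes \<theta> :: "'i \<Rightarrow> ('n::finite, 'k::{field, finite}) der"
  assumes "a \<in> residues TYPE('k)"
  shows "frob_comp_der a (\<Sum>i\<in>I. f i *s frobenius_der (\<theta> i)) = (\<Sum>i\<in>I. frob_comp a (f i) *s \<theta> i)"
  using frob_comp_frobenius_mult[OF assms]
  by (simp add: frob_comp_der_def frobenius_der_def vec_eq_iff frob_comp_sum mult.commute)

lemma frobenius_der_combination: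
  "frobenius_der (\<Sum>i\<in>I. f i *s \<theta> i) = (\<Sum>i\<in>I. frobenius (f i) *s frobenius_der (\<theta> i))"
  by (simp add: frobenius_der_def vec_eq_iff frobenius_sum frobenius_mult)

lemma frob_comp_der_decompose:
  fixes \<theta> :: "('n::finite, 'k::{field, finite}) der"
  shows "\<theta> = (\<Sum>a\<in>residues TYPE('k). Poly_Mapping.single a 1 *s frobenius_der (frob_comp_der a \<theta>))"
  by (simp add: vec_eq_iff frobenius_der_def frob_comp_der_def flip: frob_comp_decompose)

section \<open>Derivations applied to linear forms\<close>

lemma partial_deriv_linear_form:
  assumes "is_linear_form (\<alpha> :: ('n::finite, 'k::field) mpoly)"
  obtains c where "\<And>i. partial_deriv i \<alpha> = Poly_Mapping.single 0 (c i)"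
proof -
  from assms obtain c :: "'k ^ 'n"
    where \<alpha>: "\<alpha> = (\<Sum>i\<in>UNIV. Poly_Mapping.single (Poly_Mapping.single i 1) (c $ i))"
    unfolding is_linear_form_def by blast
  let ?e = "\<lambda>j :: 'n. Poly_Mapping.single j (1 :: nat)"
  have inj: "inj ?e"
    by (auto simp: inj_on_def poly_mapping_eq_iff fun_eq_iff lookup_single when_def split: if_splits)
  have lookup: "Poly_Mapping.lookup \<alpha> (?e j) = c $ j" for j
    by (simp add: \<alpha> lookup_sum lookup_single when_def inj_eq[OF inj[unfolded One_nat_def]])
  have keys: "Poly_Mapping.keys \<alpha> \<subseteq> range ?e"
    unfolding \<alpha> by (rule order.trans[OF keys_sum]) (auto split: if_splits)
  have "partial_deriv i \<alpha> = Poly_Mapping.single 0 (c $ i)" for i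
  proof -
    \<comment> \<open>Some coefficients of the form may vanish, so its support can be smaller than
      the set of unit exponents. The added terms have coefficient 0.\<close>
    have "partial_deriv i \<alpha> = (\<Sum>m\<in>range ?e.
        Poly_Mapping.single (m - ?e i) (of_nat (Poly_Mapping.lookup m i) * Poly_Mapping.lookup \<alpha> m))"
      unfolding partial_deriv_def using keys by (intro sum.mono_neutral_left) (auto simp: in_keys_iff)
    also have "\<dots> = (\<Sum>j\<in>UNIV. Poly_Mapping.single (?e j - ?e i)
        (of_nat (Poly_Mapping.lookup (?e j) i) * Poly_Mapping.lookup \<alpha> (?e j)))"
      using inj by (simp add: sum.reindex)
    \<comment> \<open>For \<open>j \<noteq> i\<close> the factor \<open>lookup (?e j) i\<close> is
      0, which makes the truncated exponent \<open>?e j - ?e i\<close> irrelevant.\<close>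
    also have "\<dots> = (\<Sum>j\<in>UNIV. if j = i then Poly_Mapping.single 0 (c $ i) else 0)"
      by (intro sum.cong refl) (auto simp: lookup[simplified] lookup_single when_def)
    finally show ?thesis by simp
  qed
  then show thesis by (rule that)
qed

text \<open>The partial derivatives of the form are constants from the field, hence their own
  Frobenius images, and so they pass through \<open>frob_comp a\<close>.\<close>

lemma frob_comp_der_apply:
  fixes \<theta> :: "('n::finite, 'k::{field, finite}) der"
  assumes a: "a \<in> residues TYPE('k)" and \<alpha>: "is_linear_form \<alpha>"
  shows "frob_comp a (der_apply \<theta> \<alpha>) = der_apply (frob_comp_der a \<theta>) \<alpha>"
proof -
  obtain c where c: "\<And>i. partial_deriv i \<alpha> = Poly_Mapping.single 0 (c i)"
    using partial_deriv_linear_form[OF \<alpha>] by blast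
  have frob: "frobenius (Poly_Mapping.single 0 (c i)) = Poly_Mapping.single 0 (c i)" for i
    by (simp add: frobenius_single)
  have "frob_comp a (\<theta> $ i * Poly_Mapping.single 0 (c i)) = frob_comp a (\<theta> $ i) * Poly_Mapping.single 0 (c i)"
    for i
    using frob_comp_frobenius_mult[OF a, of "Poly_Mapping.single 0 (c i)" "\<theta> $ i"]
    by (simp add: frob mult.commute)
  then show ?thesis
    by (simp add: der_apply_def c frob_comp_sum frob_comp_der_def)
qed

text \<open>For a submodule \<open>M\<close> this is the submodule generated by the Frobenius images
  of its elements, that is, the extension of \<open>M\<close> along Frobenius.\<close>

definition frob_extension :: "('n::finite, 'k::{field, finite}) der set \<Rightarrow> ('n, 'k) der set" where
  "frob_extension M = {\<theta>. \<forall>a\<in>residues TYPE('k). frob_comp_der a \<theta> \<in> M}"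

text \<open>The component at 0 of \<open>frobenius_der \<theta>\<close> is \<open>\<theta>\<close>
  itself, and all its components are multiples of \<open>\<theta>\<close>.\<close>

lemma frobenius_der_in_frob_extension_iff:
  assumes "module.subspace (*s) M"
  shows "frobenius_der \<theta> \<in> frob_extension M \<longleftrightarrow> \<theta> \<in> M"
proof
  assume "frobenius_der \<theta> \<in> frob_extension M"
  then have "frob_comp_der 0 (frobenius_der \<theta>) \<in> M"
    using zero_in_residues by (auto simp: frob_extension_def)
  then show "\<theta> \<in> M"
    by (simp add: frob_comp_der_frobenius_der[OF zero_in_residues])
next
  assume "\<theta> \<in> M"
  then show "frobenius_der \<theta> \<in> frob_extension M"
    using module.subspace_scale[OF module_der assms]
    by (simp add: frob_extension_def frob_comp_der_frobenius_der)
qed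

lemma frob_extension_eq_iff:
  assumes "module.subspace (*s) M" "module.subspace (*s) N"
  shows "frob_extension M = frob_extension N \<longleftrightarrow> M = N"
  using frobenius_der_in_frob_extension_iff[OF assms(1)] frobenius_der_in_frob_extension_iff[OF assms(2)]
  by blast

lemma subspace_log_der:
  fixes \<A> :: "('k::field ^ 'n::finite) set set"
  shows "module.subspace (*s) (log_der \<A> \<alpha> \<mu>)"
proof -
  have "der_apply (\<theta> + \<eta>) f = der_apply \<theta> f + der_apply \<eta> f" "der_apply (c *s \<theta>) f = c * der_apply \<theta> f"
    "der_apply 0 f = 0" for \<theta> \<eta> :: "('n, 'k) der" and c f
    by (simp_all add: der_apply_def sum.distrib sum_distrib_left algebra_simps)
  then show ?thesis
    by (simp add: module.subspace_def[OF module_der] log_der_def)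
qed

text \<open>The required power of \<open>\<alpha> H\<close> is the Frobenius image of
  \<open>\<alpha> H ^ \<mu> H\<close>, so divisibility by it can be tested on components, and these
  commute with application to \<open>\<alpha> H\<close>.\<close>

lemma frob_extension_log_der:
  fixes \<A> :: "('k::{field, finite} ^ 'n::finite) set set"
  assumes "\<And>H. H \<in> \<A> \<Longrightarrow> is_linear_form (\<alpha> H)"
  shows "frob_extension (log_der \<A> \<alpha> \<mu>) = log_der \<A> \<alpha> (\<lambda>H. CARD('k) * \<mu> H)"
  using assms unfolding frob_extension_def log_der_def
  by (auto simp: frobenius_dvd_iff frob_comp_der_apply simp flip: frobenius_power)

section \<open>Spans, independence and bases of indexed families\<close>

abbreviation combinations :: "('i::finite \<Rightarrow> ('n::finite, 'k::field) der) \<Rightarrow> ('n, 'k) der set" where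
  "combinations \<theta> \<equiv> range (\<lambda>f. \<Sum>i\<in>UNIV. f i *s \<theta> i)"

lemma subspace_combinations: "module.subspace (*s) (combinations \<theta>)"
proof (rule module.subspaceI[OF module_der])
  show "0 \<in> combinations \<theta>"
    by (rule image_eqI[where x = "\<lambda>_. 0"]) simp_all
next
  fix x y assume "x \<in> combinations \<theta>" "y \<in> combinations \<theta>"
  then obtain f g where "x = (\<Sum>i\<in>UNIV. f i *s \<theta> i)" "y = (\<Sum>i\<in>UNIV. g i *s \<theta> i)"
    by blast
  then have "x + y = (\<Sum>i\<in>UNIV. (f i + g i) *s \<theta> i)"
    by (simp add: sum.distrib vec_eq_iff distrib_right)
  then show "x + y \<in> combinations \<theta>" by (rule image_eqI[where x = "\<lambda>i. f i + g i"]) simp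
next
  fix c x assume "x \<in> combinations \<theta>"
  then obtain f where "x = (\<Sum>i\<in>UNIV. f i *s \<theta> i)"
    by blast
  then have "c *s x = (\<Sum>i\<in>UNIV. (c * f i) *s \<theta> i)"
    by (simp add: vec_eq_iff sum_distrib_left mult.assoc)
  then show "c *s x \<in> combinations \<theta>" by (rule image_eqI[where x = "\<lambda>i. c * f i"]) simp
qed

text \<open>If the component at \<open>a\<close> has coefficients \<open>g a i\<close>, reassembling
  the components yields the coefficient \<open>\<Sum>a. x^a * frobenius (g a i)\<close> at
  \<open>frobenius_der (\<theta> i)\<close>.\<close>

lemma frob_extension_combinations:
  fixes \<theta> :: "'i::finite \<Rightarrow> ('n::finite, 'k::{field, finite}) der"
  shows "frob_extension (combinations \<theta>) = combinations (\<lambda>i. frobenius_der (\<theta> i))"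
proof
  show "combinations (\<lambda>i. frobenius_der (\<theta> i)) \<subseteq> frob_extension (combinations \<theta>)"
    by (auto simp: frob_extension_def frob_comp_der_combination)
  show "frob_extension (combinations \<theta>) \<subseteq> combinations (\<lambda>i. frobenius_der (\<theta> i))"
  proof
    fix \<eta> :: "('n, 'k) der" assume "\<eta> \<in> frob_extension (combinations \<theta>)"
    then have "\<forall>a\<in>residues TYPE('k). \<exists>g. frob_comp_der a \<eta> = (\<Sum>i\<in>UNIV. g i *s \<theta> i)"
      by (auto simp: frob_extension_def)
    then obtain g where "\<And>a. a \<in> residues TYPE('k) \<Longrightarrow> frob_comp_der a \<eta> = (\<Sum>i\<in>UNIV. g a i *s \<theta> i)"
      by metis
    then have "(\<Sum>a\<in>residues TYPE('k). Poly_Mapping.single a 1 *s frobenius_der (frob_comp_der a \<eta>)) =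
        (\<Sum>a\<in>residues TYPE('k). \<Sum>i\<in>UNIV.
           (Poly_Mapping.single a 1 * frobenius (g a i)) *s frobenius_der (\<theta> i))"
      by (intro sum.cong) (simp_all add: frobenius_der_combination module.scale_sum_right[OF module_der])
    also have "\<dots> = (\<Sum>i\<in>UNIV. (\<Sum>a\<in>residues TYPE('k).
        Poly_Mapping.single a 1 * frobenius (g a i)) *s frobenius_der (\<theta> i))"
      by (subst sum.swap) (simp add: vec_eq_iff sum_distrib_right)
    finally show "\<eta> \<in> combinations (\<lambda>i. frobenius_der (\<theta> i))"
      by (auto simp flip: frob_comp_der_decompose)
  qed
qed

definition independent_family :: "('i::finite \<Rightarrow> ('n::finite, 'k::field) der) \<Rightarrow> bool" where
  "independent_family \<theta> \<longleftrightarrow> (\<forall>f. (\<Sum>i\<in>UNIV. f i *s \<theta> i) = 0 \<longrightarrow> (\<forall>i. f i = 0))"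

lemma independent_familyD:
  "independent_family \<theta> \<Longrightarrow> (\<Sum>i\<in>UNIV. f i *s \<theta> i) = 0 \<Longrightarrow> f i = 0"
  by (simp add: independent_family_def)

text \<open>Independence of the family forces injectivity, and for an injective family the set-based
  and indexed notions agree.\<close>

lemma is_basis_iff:
  fixes \<theta> :: "'i::finite \<Rightarrow> ('n::finite, 'k::field) der"
  shows "is_basis \<theta> M \<longleftrightarrow> independent_family \<theta> \<and> combinations \<theta> = M"
proof -
  have inj: "inj \<theta>" if "independent_family \<theta>"
  proof (rule injI, rule ccontr)
    fix i j assume ij: "\<theta> i = \<theta> j" "i \<noteq> j"
    \<comment> \<open>A repeated member gives the nontrivial relation
      \<open>\<theta> i - \<theta> j = 0\<close>.\<close>
    define f :: "'i \<Rightarrow> ('n, 'k) mpoly" where "f = (\<lambda>k. (if k = i then 1 else 0) - (if k = j then 1 else 0))"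
    have "(\<Sum>k\<in>UNIV. f k *s \<theta> k) =
        (\<Sum>k\<in>UNIV. (if k = i then \<theta> i else 0) - (if k = j then \<theta> j else 0))"
      by (intro sum.cong) (auto simp: f_def vec_eq_iff)
    also have "\<dots> = 0"
      using ij by (simp add: sum_subtractf)
    finally have "f i = 0"
      using that by (simp add: independent_family_def)
    with ij show False by (simp add: f_def)
  qed
  have "(\<not> module.dependent (*s) (range \<theta>) \<longleftrightarrow> independent_family \<theta>) \<and>
      module.span (*s) (range \<theta>) = combinations \<theta>" if "inj \<theta>"
  proof -
    have reindex: "(\<Sum>v\<in>range \<theta>. u v *s v) = (\<Sum>i\<in>UNIV. u (\<theta> i) *s \<theta> i)" for u
      using that by (simp add: sum.reindex)
    \<comment> \<open>Injectivity turns coefficients attached to indices into coefficients attached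
      to vectors.\<close>
    have surj: "\<exists>u. f = (\<lambda>i. u (\<theta> i))" for f :: "'i \<Rightarrow> ('n, 'k) mpoly"
      using that by (intro exI[of _ "\<lambda>v. f (inv \<theta> v)"]) simp
    have all: "(\<forall>u. Q (\<lambda>i. u (\<theta> i))) \<longleftrightarrow> (\<forall>f. Q f)" for Q :: "('i \<Rightarrow> ('n, 'k) mpoly) \<Rightarrow> bool"
      using surj by metis
    have "\<not> module.dependent (*s) (range \<theta>) \<longleftrightarrow> independent_family \<theta>"
    proof -
      have "\<not> module.dependent (*s) (range \<theta>) \<longleftrightarrow>
          (\<forall>u. (\<Sum>i\<in>UNIV. u (\<theta> i) *s \<theta> i) = 0 \<longrightarrow> (\<forall>i. u (\<theta> i) = 0))"
        unfolding module.dependent_finite[OF module_der finite_imageI[OF finite]] reindex by blast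
      also have "\<dots> \<longleftrightarrow> independent_family \<theta>"
        using all[of "\<lambda>f. (\<Sum>i\<in>UNIV. f i *s \<theta> i) = 0 \<longrightarrow> (\<forall>i. f i = 0)"]
        unfolding independent_family_def by simp
      finally show ?thesis .
    qed
    moreover have "module.span (*s) (range \<theta>) = combinations \<theta>"
      unfolding module.span_finite[OF module_der finite_imageI[OF finite]] reindex
    proof (intro equalityI subsetI)
      fix x assume "x \<in> combinations \<theta>"
      then obtain f where "x = (\<Sum>i\<in>UNIV. f i *s \<theta> i)" by blast
      moreover obtain u where "f = (\<lambda>i. u (\<theta> i))" using surj by blast
      ultimately show "x \<in> range (\<lambda>u. \<Sum>i\<in>UNIV. u (\<theta> i) *s \<theta> i)" by blast
    next
      fix x assume "x \<in> range (\<lambda>u. \<Sum>i\<in>UNIV. u (\<theta> i) *s \<theta> i)"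
      then obtain u where "x = (\<Sum>i\<in>UNIV. u (\<theta> i) *s \<theta> i)" by blast
      then show "x \<in> combinations \<theta>"
        by (rule image_eqI[where x = "\<lambda>i. u (\<theta> i)"]) simp
    qed
    ultimately show ?thesis ..
  qed
  with inj show ?thesis
    unfolding is_basis_def by blast
qed

text \<open>Components of a relation among the images are relations among the
  \<open>\<theta> i\<close>. In the other direction, Frobenius is applied to a relation.\<close>

lemma independent_family_frobenius_der_iff:
  fixes \<theta> :: "'i::finite \<Rightarrow> ('n::finite, 'k::{field, finite}) der"
  shows "independent_family (\<lambda>i. frobenius_der (\<theta> i)) \<longleftrightarrow> independent_family \<theta>"
proof
  assume indep: "independent_family \<theta>"
  show "independent_family (\<lambda>i. frobenius_der (\<theta> i))"
    unfolding independent_family_def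
  proof (intro allI impI)
    fix f i assume f: "(\<Sum>i\<in>UNIV. f i *s frobenius_der (\<theta> i)) = 0"
    have "frob_comp a (f i) = 0" if a: "a \<in> residues TYPE('k)" for a
    proof -
      have "(\<Sum>i\<in>UNIV. frob_comp a (f i) *s \<theta> i) = frob_comp_der a 0"
        using frob_comp_der_combination[OF a, of f \<theta> UNIV] f by simp
      also have "\<dots> = 0"
        by (simp add: frob_comp_der_def vec_eq_iff)
      finally show ?thesis
        by (rule independent_familyD[OF indep, of "\<lambda>i. frob_comp a (f i)"])
    qed
    then show "f i = 0" by (rule frob_comp_eq_0_imp)
  qed
next
  assume indep: "independent_family (\<lambda>i. frobenius_der (\<theta> i))"
  show "independent_family \<theta>"
    unfolding independent_family_def
  proof (intro allI impI)
    fix f i assume "(\<Sum>i\<in>UNIV. f i *s \<theta> i) = 0"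
    then have "(\<Sum>i\<in>UNIV. frobenius (f i) *s frobenius_der (\<theta> i)) = frobenius_der 0"
      by (simp flip: frobenius_der_combination)
    also have "\<dots> = 0"
      by (simp add: frobenius_der_def vec_eq_iff)
    finally have "frobenius (f i) = 0"
      by (rule independent_familyD[OF indep, of "\<lambda>i. frobenius (f i)"])
    \<comment> \<open>The component at 0 undoes Frobenius, which is therefore injective.\<close>
    then show "f i = 0"
      using frob_comp_frobenius[OF zero_in_residues, of "f i"] by simp
  qed
qed

theorem theorem2p2:
  fixes \<A> :: "('k::{field, finite} ^ 'n::finite) set set"
    and \<alpha> :: "('k ^ 'n) set \<Rightarrow> ('n, 'k) mpoly"
    and \<mu> :: "('k ^ 'n) set \<Rightarrow> nat"
    and \<theta> :: "'n \<Rightarrow> ('n, 'k) der"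
  assumes "arrangement \<A>"
    and "defining_forms \<A> \<alpha>"
  shows "is_basis \<theta> (log_der \<A> \<alpha> \<mu>) \<longleftrightarrow>
         is_basis (\<lambda>i. frobenius_der (\<theta> i)) (log_der \<A> \<alpha> (\<lambda>H. CARD('k) * \<mu> H))"
proof -
  have "log_der \<A> \<alpha> (\<lambda>H. CARD('k) * \<mu> H) = frob_extension (log_der \<A> \<alpha> \<mu>)"
    using assms(2) by (intro frob_extension_log_der[symmetric]) (simp add: defining_forms_def)
  then show ?thesis
    by (simp add: is_basis_iff independent_family_frobenius_der_iff
        frob_extension_eq_iff subspace_combinations subspace_log_der
        flip: frob_extension_combinations)
qed

end
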